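(* Let $q$ be a prime power with $\mathrm{char}\,\mathbb{F}_q\ne 3$ and $q\ge 5$. Let \[ f(X)=aX+\frac{1}{X-r}+\frac{1}{X-r^q}+\frac{1}{X-r^{q^2}}, \] where $a\in\mathbb{F}_q^*$ and $r\in\mathbb{F}_{q^3}\setminus\mathbb{F}_q$. Then $f$ is not a permutation rational function of $\mathbb{P}^1(\mathbb{F}_q)$.
   Context: $\mathbb{P}^1(\mathbb{F}_q)=\mathbb{F}_q\cup\{\infty\}$ is the projective line over $\mathbb{F}_q$. A rational function $f=P/Q\in\mathbb{F}_q(X)$ ($P,Q$ coprime) defines a map $\mathbb{P}^1(\mathbb{F}_q)\to\mathbb{P}^1(\mathbb{F}_q)$ in the usual way (zeros of $Q$ map to $\infty$, and $f(\infty)$ is the limiting value). A permutation rational function of $\mathbb{P}^1(\mathbb{F}_q)$ is a rational function whose induced map on $\mathbb{P}^1(\mathbb{F}_q)$ is a bijection. *)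

theory Defs
  imports
    "HOL-Computational_Algebra.Computational_Algebra"
    "HOL-Number_Theory.Prime_Powers"
begin

definition is_subfield :: "'a::field set \<Rightarrow> bool" where
  "is_subfield K \<longleftrightarrow> 0 \<in> K \<and> 1 \<in> K \<and>
     (\<forall>x\<in>K. \<forall>y\<in>K. x + y \<in> K \<and> x * y \<in> K) \<and>
     (\<forall>x\<in>K. - x \<in> K \<and> inverse x \<in> K)"

datatype 'a proj_line = Affine 'a | Infinity

definition proj_line_over :: "'a set \<Rightarrow> 'a proj_line set" where
  "proj_line_over K = insert Infinity (Affine ` K)"

text \<open>The map of the projective line induced by the quotient of two coprime polynomials
  \<open>P\<close> and \<open>Q\<close>, where \<open>Q\<close> is not zero.\<close>

fun quotient_map :: "'a::field poly \<Rightarrow> 'a poly \<Rightarrow> 'a proj_line \<Rightarrow> 'a proj_line" where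
  "quotient_map P Q (Affine x) =
     (if poly Q x = 0 then Infinity else Affine (poly P x / poly Q x))"
| "quotient_map P Q Infinity =
     (if degree P > degree Q then Infinity
      else if degree P < degree Q then Affine 0
      else Affine (lead_coeff P / lead_coeff Q))"

definition reduced_form :: "'a::field poly fract \<Rightarrow> 'a poly \<Rightarrow> 'a poly \<Rightarrow> bool" where
  "reduced_form f P Q \<longleftrightarrow> Q \<noteq> 0 \<and> coprime P Q \<and> f = Fract P Q"

text \<open>The value does not depend on the reduced form that is chosen; see
  \<open>reduced_form_exists\<close> and \<open>ratfun_map_eq\<close> below.\<close>

definition ratfun_map :: "'a::field poly fract \<Rightarrow> 'a proj_line \<Rightarrow> 'a proj_line" where
  "ratfun_map f = (case (SOME (P, Q). reduced_form f P Q) of (P, Q) \<Rightarrow> quotient_map P Q)"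

text \<open>The field \<open>K\<close> is a subfield of the coefficient field. For \<open>f\<close> in \<open>K(X)\<close>, a reduced
  form over \<open>K\<close> is also reduced over the larger field, so that \<open>ratfun_map f\<close> restricts to
  the map that \<open>f\<close> induces on the projective line over \<open>K\<close>.\<close>

definition permutation_ratfun :: "'a::field set \<Rightarrow> 'a poly fract \<Rightarrow> bool" where
  "permutation_ratfun K f \<longleftrightarrow>
     bij_betw (ratfun_map f) (proj_line_over K) (proj_line_over K)"

definition ratX :: "'a::field poly fract" where
  "ratX = to_fract [:0, 1:]"

definition ratC :: "'a::field \<Rightarrow> 'a poly fract" where
  "ratC c = to_fract [:c:]"

lemma reduced_form_exists:
  fixes f :: "'a::field poly fract"
  shows "\<exists>P Q. reduced_form f P Q"
proof -
  define R where "R n \<longleftrightarrow> (\<exists>P Q. Q \<noteq> 0 \<and> f = Fract P Q \<and> degree Q = n)" for n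
  have "\<exists>n. R n"
    unfolding R_def by (cases f rule: Fract_cases) blast
  then have "R (LEAST n. R n)"
    by (rule LeastI_ex)
  then obtain P Q where PQ: "Q \<noteq> 0" "f = Fract P Q" "degree Q = (LEAST n. R n)"
    unfolding R_def by blast
  have "coprime P Q"
  proof (rule coprimeI)
    fix d assume "d dvd P" "d dvd Q"
    then obtain P' Q' where d: "P = d * P'" "Q = d * Q'"
      by (auto elim!: dvdE)
    then have nz: "d \<noteq> 0" "Q' \<noteq> 0"
      using PQ(1) by auto
    have "f = Fract P' Q'"
      using PQ(1,2) nz d by (simp add: eq_fract)
    then have "R (degree Q')"
      using nz unfolding R_def by blast
    then have "degree Q \<le> degree Q'"
      unfolding PQ(3) by (rule Least_le)
    then have "degree d = 0"
      using nz d by (simp add: degree_mult_eq)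
    then show "is_unit d"
      using nz by (simp add: is_unit_iff_degree)
  qed
  with PQ show ?thesis
    unfolding reduced_form_def by blast
qed

lemma coprime_poly_bezout:
  fixes P Q :: "'a::field poly"
  assumes "coprime P Q" "Q \<noteq> 0"
  shows "\<exists>u v. u * P + v * Q = 1"
proof -
  define I where "I = {u * P + v * Q | u v. True}"
  define R where "R n \<longleftrightarrow> (\<exists>d\<in>I. d \<noteq> 0 \<and> degree d = n)" for n
  have PI: "P \<in> I" and QI: "Q \<in> I"
    unfolding I_def
    by (auto intro: exI[of _ 0] exI[of _ 1])
  then have "\<exists>n. R n"
    using assms(2) unfolding R_def by blast
  then have "R (LEAST n. R n)"
    by (rule LeastI_ex)
  then obtain d where d: "d \<in> I" "d \<noteq> 0" "degree d = (LEAST n. R n)"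
    unfolding R_def by blast
  have dvd: "d dvd x" if "x \<in> I" for x
  proof (rule ccontr)
    assume "\<not> d dvd x"
    then have nz: "x mod d \<noteq> 0"
      by (simp add: dvd_eq_mod_eq_0)
    obtain u v u' v' where uv: "x = u * P + v * Q" "d = u' * P + v' * Q"
      using \<open>x \<in> I\<close> d(1) unfolding I_def by blast
    have "x mod d = x - (x div d) * d"
      by (simp add: minus_div_mult_eq_mod)
    also have "\<dots> = (u - (x div d) * u') * P + (v - (x div d) * v') * Q"
      by (subst (1) uv(1), subst (2) uv(2)) (simp add: algebra_simps)
    finally have "x mod d \<in> I"
      unfolding I_def by blast
    then have "R (degree (x mod d))"
      using nz unfolding R_def by blast
    then have "degree d \<le> degree (x mod d)"
      unfolding d(3) by (rule Least_le)
    then show False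
      using degree_mod_less[OF d(2), of x] nz by simp
  qed
  have "is_unit d"
    using assms(1) dvd[OF PI] dvd[OF QI] by (rule coprime_common_divisor)
  then obtain e where e: "1 = d * e"
    by (auto elim: dvdE)
  obtain u v where "d = u * P + v * Q"
    using d(1) unfolding I_def by blast
  then have "(e * u) * P + (e * v) * Q = 1"
    using e by (simp add: algebra_simps)
  then show ?thesis
    by blast
qed

lemma quotient_map_smult:
  assumes "c \<noteq> (0::'a::field)"
  shows "quotient_map (smult c P) (smult c Q) = quotient_map P Q"
proof
  fix x show "quotient_map (smult c P) (smult c Q) x = quotient_map P Q x"
    using assms by (cases x) auto
qed

lemma ratfun_map_eq:
  fixes f :: "'a::field poly fract"
  assumes "reduced_form f P Q"
  shows "ratfun_map f = quotient_map P Q"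
proof -
  obtain P' Q' where S: "(SOME (P, Q). reduced_form f P Q) = (P', Q')"
    by (cases "SOME (P, Q). reduced_form f P Q")
  have "reduced_form f P' Q'"
    using someI[of "\<lambda>(P, Q). reduced_form f P Q" "(P, Q)"] assms S by simp
  then have nz: "Q \<noteq> 0" "Q' \<noteq> 0" and cop: "coprime P Q" "coprime P' Q'"
    and eq: "P * Q' = P' * Q"
    using assms unfolding reduced_form_def by (auto simp: eq_fract)
  obtain u v where uv: "u * P + v * Q = 1"
    using coprime_poly_bezout[OF cop(1) nz(1)] by blast
  obtain u' v' where uv': "u' * P' + v' * Q' = 1"
    using coprime_poly_bezout[OF cop(2) nz(2)] by blast
  define k where "k = u * P' + v * Q'"
  have Q': "Q' = k * Q"
  proof -
    have "Q' = (u * P + v * Q) * Q'"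
      using uv by simp
    also have "\<dots> = u * (P * Q') + v * Q * Q'"
      by (simp add: algebra_simps)
    also have "\<dots> = k * Q"
      unfolding eq k_def by (simp add: algebra_simps)
    finally show ?thesis .
  qed
  have P': "P' = k * P"
    using eq nz(1) unfolding Q' by (simp add: algebra_simps)
  have "k * (u' * P + v' * Q) = 1"
    using uv' unfolding P' Q' by (simp add: algebra_simps)
  then have "is_unit k"
    by (metis dvd_triv_left)
  then obtain c where "k = [:c:]" "c dvd 1"
    unfolding is_unit_poly_iff by blast
  then have c: "k = [:c:]" "c \<noteq> 0"
    by auto
  have "ratfun_map f = quotient_map P' Q'"
    unfolding ratfun_map_def S by simp
  also have "\<dots> = quotient_map P Q"
    using quotient_map_smult[OF c(2), of P Q] unfolding P' Q' c(1) by simp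
  finally show ?thesis .
qed

end

theory Submission
  imports Defs
begin

text \<open>If \<open>f\<close> permutes the projective line, then \<open>F(x) = a x + \<Sum>\<^sub>i 1 / (x - r\<^sub>i)\<close> with
  \<open>r\<^sub>1 = r\<close>, \<open>r\<^sub>2 = r\<^sub>1\<^sup>q\<close>, \<open>r\<^sub>3 = r\<^sub>2\<^sup>q\<close> permutes \<open>K\<close>, so for \<open>k = 1, 2, 3\<close> the sum of \<open>F(x) ^ k\<close> over \<open>K\<close>
  vanishes, as does that of \<open>x ^ k\<close>. The sums of \<open>F ^ k\<close> are computable because the sum of
  \<open>1 / (x - t) ^ k\<close> over \<open>K\<close> is \<open>1 / (t\<^sup>q - t) ^ k\<close>. The case \<open>k = 1\<close> forces \<open>r\<^sub>3 - r\<^sub>2 = w (r\<^sub>2 - r\<^sub>1)\<close> with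
  \<open>w\<^sup>2 + w + 1 = 0\<close>. Then the sum for \<open>k = 2\<close> is \<open>2 a (w\<^sup>2 - 1)\<close>, which is nonzero in odd characteristic
  other than 3, and in characteristic 2 the sum for \<open>k = 3\<close> is \<open>w / (r\<^sub>2 - r\<^sub>1) ^ 3\<close>, which is
  nonzero.\<close>

section \<open>Finite subfields and the power map with exponent \<open>card K\<close>\<close>

lemma subfield_minus_closed:
  assumes "is_subfield K" "x \<in> K" "y \<in> K"
  shows "x - y \<in> K"
  using assms unfolding is_subfield_def by (metis add_uminus_conv_diff)

lemma subfield_divide_closed:
  assumes "is_subfield K" "x \<in> K" "y \<in> K"
  shows "x / y \<in> K"
  using assms unfolding is_subfield_def by (metis divide_inverse)

text \<open>Multiplication by \<open>x\<close> permutes the nonzero elements, so it preserves their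
  product, which is then cancelled.\<close>

lemma subfield_power_card_minus_1:
  fixes K :: "'a::field set"
  assumes K: "is_subfield K" "finite K" and x: "x \<in> K" "x \<noteq> 0"
  shows "x ^ (card K - 1) = 1"
proof -
  have "x ^ (card K - 1) * \<Prod>(K - {0}) = (\<Prod>y\<in>K - {0}. x * y)"
    using K by (simp add: prod.distrib is_subfield_def)
  also have "\<dots> = \<Prod>(K - {0})"
    by (rule prod.reindex_bij_witness[of _ "\<lambda>y. y / x" "\<lambda>y. x * y"])
      (use K x subfield_divide_closed in \<open>auto simp: is_subfield_def\<close>)
  finally show ?thesis
    using K(2) by simp
qed

lemma card_subfield_ge_2:
  fixes K :: "'a::field set"
  assumes "is_subfield K" "finite K"
  shows "card K \<ge> 2"
proof -
  have "card {0, 1 :: 'a} \<le> card K"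
    by (rule card_mono) (use assms in \<open>auto simp: is_subfield_def\<close>)
  then show ?thesis
    by simp
qed

lemma subfield_power_card:
  fixes K :: "'a::field set"
  assumes "is_subfield K" "finite K" "x \<in> K"
  shows "x ^ card K = x"
proof (cases "x = 0")
  case False
  have "x ^ card K = x * x ^ (card K - 1)"
    using card_subfield_ge_2[OF assms(1,2)] by (simp flip: power_Suc)
  then show ?thesis
    using subfield_power_card_minus_1[OF assms False] by simp
qed (use card_subfield_ge_2[OF assms(1,2)] in simp)

text \<open>With \<open>q = card K\<close>, the polynomial \<open>X ^ q - X\<close> has at most
  \<open>q\<close> roots, and \<open>K\<close> already supplies that many.\<close>

lemma subfield_eq_power_card_fixpoints:
  fixes K :: "'a::field set"
  assumes K: "is_subfield K" "finite K"
  shows "K = {x. x ^ card K = x}"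
proof -
  define p :: "'a poly" where "p = monom 1 (card K) - monom 1 1"
  have "coeff p (card K) = 1"
    using card_subfield_ge_2[OF K] by (simp add: p_def)
  then have p: "p \<noteq> 0"
    by auto
  have "degree p \<le> card K"
    unfolding p_def using card_subfield_ge_2[OF K]
    by (intro degree_diff_le) (simp_all add: degree_monom_eq)
  moreover have roots: "{x. poly p x = 0} = {x. x ^ card K = x}"
    by (simp add: p_def poly_monom)
  ultimately have "card {x :: 'a. x ^ card K = x} \<le> card K"
    using card_poly_roots_bound[OF p] by simp
  moreover have "finite {x :: 'a. x ^ card K = x}"
    using poly_roots_finite[OF p] roots by simp
  moreover have "K \<subseteq> {x. x ^ card K = x}"
    using subfield_power_card[OF K] by blast
  ultimately show ?thesis
    by (simp add: card_seteq)
qed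

section \<open>Power sums over a finite subfield\<close>

lemma of_nat_card_subfield:
  fixes K :: "'a::field set"
  assumes "is_subfield K" "finite K"
  shows "of_nat (card K) = (0 :: 'a)"
proof -
  \<comment> \<open>Translation by 1 permutes \<open>K\<close>, so the sum is unchanged although it
    gains a 1 for each element.\<close>
  have "(\<Sum>x\<in>K. x) = (\<Sum>x\<in>K. x + 1)"
    by (rule sum.reindex_bij_witness[of _ "\<lambda>y. y + 1" "\<lambda>y. y - 1"])
      (use assms subfield_minus_closed in \<open>auto simp: is_subfield_def\<close>)
  then show ?thesis
    by (simp add: sum.distrib)
qed

text \<open>Scaling by \<open>g\<close> permutes \<open>K\<close> and multiplies the sum by
  \<open>g ^ i\<close>. For \<open>i > 0\<close>, counting roots of \<open>X ^ i - 1\<close> yields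
  a nonzero \<open>g\<close> with \<open>g ^ i \<noteq> 1\<close>; for \<open>i = 0\<close> the sum
  is \<open>card K\<close>, which is 0 in the field.\<close>

lemma sum_power_subfield_eq_0:
  fixes K :: "'a::field set"
  assumes K: "is_subfield K" "finite K" and i: "i < card K - 1"
  shows "(\<Sum>x\<in>K. x ^ i) = 0"
proof (cases "i = 0")
  case True
  then show ?thesis
    using of_nat_card_subfield[OF K] by simp
next
  case False
  define p :: "'a poly" where "p = monom 1 i - 1"
  have "coeff p i = 1"
    using False by (simp add: p_def)
  then have p: "p \<noteq> 0"
    by auto
  have "degree p \<le> i"
    unfolding p_def by (intro degree_diff_le) (simp_all add: degree_monom_eq)
  then have "card {x. poly p x = 0} < card (K - {0})"
    using card_poly_roots_bound[OF p] i K by (simp add: is_subfield_def)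
  then have "\<not> K - {0} \<subseteq> {x. poly p x = 0}"
    using card_mono[OF poly_roots_finite[OF p]] not_le by blast
  then obtain g where g: "g \<in> K" "g \<noteq> 0" "g ^ i \<noteq> 1"
    by (auto simp: p_def poly_monom)
  have "(\<Sum>x\<in>K. x ^ i) = (\<Sum>x\<in>K. (g * x) ^ i)"
    by (rule sum.reindex_bij_witness[of _ "\<lambda>y. g * y" "\<lambda>y. y / g"])
      (use K g subfield_divide_closed in \<open>auto simp: is_subfield_def\<close>)
  also have "\<dots> = g ^ i * (\<Sum>x\<in>K. x ^ i)"
    by (simp add: power_mult_distrib sum_distrib_left)
  finally show ?thesis
    using g(3) by simp
qed

lemma sum_power_card_minus_1_subfield:
  fixes K :: "'a::field set"
  assumes K: "is_subfield K" "finite K"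
  shows "(\<Sum>x\<in>K. x ^ (card K - 1)) = - 1"
proof -
  have "(\<Sum>x\<in>K. x ^ (card K - 1)) = (\<Sum>x\<in>K - {0}. x ^ (card K - 1))"
    using K card_subfield_ge_2[OF K] by (intro sum.mono_neutral_right) auto
  also have "\<dots> = (\<Sum>x\<in>K - {0}. 1)"
    by (rule sum.cong) (use subfield_power_card_minus_1[OF K] in auto)
  also have "\<dots> = of_nat (card K) - 1"
    using K card_subfield_ge_2[OF K] by (simp add: is_subfield_def)
  finally show ?thesis
    using of_nat_card_subfield[OF K] by simp
qed

text \<open>As \<open>t\<close> may lie outside \<open>K\<close>, the shift need not permute
  \<open>K\<close>. In the binomial expansion every exponent \<open>k < i\<close> is below
  \<open>card K - 1\<close> and sums to 0, so only the top power survives.\<close>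

lemma sum_shifted_power_subfield:
  fixes K :: "'a::field set"
  assumes K: "is_subfield K" "finite K" and i: "i < card K"
  shows "(\<Sum>x\<in>K. (x - t) ^ i) = (if i = card K - 1 then - 1 else 0)"
proof -
  have "(\<Sum>x\<in>K. (x - t) ^ i) = (\<Sum>x\<in>K. \<Sum>k\<le>i. of_nat (i choose k) * x ^ k * (- t) ^ (i - k))"
    using binomial_ring[of _ "- t" i] by simp
  also have "\<dots> = (\<Sum>k\<le>i. of_nat (i choose k) * (- t) ^ (i - k) * (\<Sum>x\<in>K. x ^ k))"
    by (subst sum.swap) (simp add: sum_distrib_left sum_distrib_right mult_ac)
  also have "\<dots> = (\<Sum>k\<in>{i}. of_nat (i choose k) * (- t) ^ (i - k) * (\<Sum>x\<in>K. x ^ k))"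
    by (rule sum.mono_neutral_right) (use i sum_power_subfield_eq_0[OF K] in auto)
  also have "\<dots> = (\<Sum>x\<in>K. x ^ i)"
    by simp
  also have "\<dots> = (if i = card K - 1 then - 1 else 0)"
    using sum_power_subfield_eq_0[OF K] sum_power_card_minus_1_subfield[OF K] i by simp
  finally show ?thesis .
qed

section \<open>Frobenius and sums of powers of a simple pole\<close>

lemma power_card_subfield_add:
  fixes K :: "'a::finite_field set" and x y :: 'a
  assumes "is_subfield K" "primepow (card K)"
  shows "(x + y) ^ card K = x ^ card K + y ^ card K"
proof -
  obtain p n where pn: "prime p" "card K = p ^ n"
    using assms(2) unfolding primepow_def by blast
  have char: "prime CHAR('a)"
    by (rule prime_CHAR_semidom) simp
  \<comment> \<open>Since \<open>card K\<close> is 0 in the field, it is a power of the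
    characteristic.\<close>
  have "CHAR('a) dvd p ^ n"
    using of_nat_card_subfield[OF assms(1)] pn(2) of_nat_eq_0_iff_char_dvd finite by metis
  then have "CHAR('a) = p"
    using char pn(1) prime_dvd_power primes_dvd_imp_eq by blast
  then show ?thesis
    using freshmans_dream'[OF char] pn(2) by blast
qed

lemma power_card_subfield_diff:
  fixes K :: "'a::finite_field set" and x y :: 'a
  assumes "is_subfield K" "primepow (card K)"
  shows "(x - y) ^ card K = x ^ card K - y ^ card K"
  using power_card_subfield_add[OF assms, of "x - y" y] by simp

text \<open>For \<open>d = t\<^sup>q - t\<close> and \<open>x\<close> in the subfield, \<open>(x - t)\<^sup>q = x - t - d\<close>, so that \<open>1 / (x - t)\<close>
  is the polynomial \<open>(1 - (x - t) ^ (q - 1)) / d\<close> in \<open>x\<close>.\<close>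

lemma sum_inverse_power_subfield:
  fixes K :: "'a::finite_field set"
  assumes K: "is_subfield K" "primepow (card K)" and t: "t \<notin> K"
    and k: "k \<ge> 1" "k < card K"
  shows "(\<Sum>x\<in>K. (1 / (x - t)) ^ k) = (1 / (t ^ card K - t)) ^ k"
proof -
  define q where "q = card K"
  define d where "d = t ^ q - t"
  have fin: "finite K"
    by simp
  have d: "d \<noteq> 0"
    using t subfield_eq_power_card_fixpoints[OF K(1) fin] unfolding d_def q_def by auto
  have inv: "1 / (x - t) = (1 - (x - t) ^ (q - 1)) / d" if "x \<in> K" for x
  proof -
    have nz: "x - t \<noteq> 0"
      using that t by auto
    have "(x - t) * (x - t) ^ (q - 1) = (x - t) ^ q"
      using k unfolding q_def by (simp flip: power_Suc)
    also have "\<dots> = x - t - d"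
      by (simp add: d_def q_def power_card_subfield_diff[OF K] subfield_power_card[OF K(1) fin that])
    finally have "(x - t) * (1 - (x - t) ^ (q - 1)) = d"
      by (simp add: algebra_simps)
    then show ?thesis
      using nz d by (simp add: field_simps)
  qed
  have "(\<Sum>x\<in>K. (1 / (x - t)) ^ k) = (1 / d) ^ k"
    using k
  proof (induction k rule: nat_induct_at_least)
    case base
    have "(\<Sum>x\<in>K. 1 / (x - t)) = (\<Sum>x\<in>K. (1 - (x - t) ^ (q - 1)) / d)"
      by (rule sum.cong) (use inv in auto)
    also have "\<dots> = (of_nat (card K) - (\<Sum>x\<in>K. (x - t) ^ (q - 1))) / d"
      by (simp add: sum_subtractf flip: sum_divide_distrib)
    also have "\<dots> = 1 / d"
      using sum_shifted_power_subfield[OF K(1) fin, of "q - 1" t] of_nat_card_subfield[OF K(1) fin]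
        k by (simp add: q_def)
    finally show ?case
      by simp
  next
    case (Suc k)
    \<comment> \<open>Putting one factor in polynomial form trades it for \<open>1 / d\<close>, up
      to a power of \<open>x - t\<close> whose exponent is below \<open>q - 1\<close> because
      \<open>k \<ge> 1\<close>; that power sums to 0.\<close>
    have "(1 / (x - t)) ^ Suc k = (1 / (x - t)) ^ k / d - (x - t) ^ (q - 1 - k) / d"
      if "x \<in> K" for x
    proof -
      have nz: "x - t \<noteq> 0"
        using that t by auto
      have "(x - t) ^ (q - 1) = (x - t) ^ (q - 1 - k) * (x - t) ^ k"
        using Suc.prems unfolding q_def by (simp flip: power_add)
      then have "(1 / (x - t)) ^ k * (x - t) ^ (q - 1) = (x - t) ^ (q - 1 - k)"
        using nz by (simp add: power_divide)
      moreover have "(1 / (x - t)) ^ Suc k = (1 / (x - t)) ^ k * ((1 - (x - t) ^ (q - 1)) / d)"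
        using inv[OF that] by simp
      ultimately show ?thesis
        by (simp add: right_diff_distrib diff_divide_distrib)
    qed
    then have "(\<Sum>x\<in>K. (1 / (x - t)) ^ Suc k) =
        (\<Sum>x\<in>K. (1 / (x - t)) ^ k) / d - (\<Sum>x\<in>K. (x - t) ^ (q - 1 - k)) / d"
      by (simp add: sum_subtractf flip: sum_divide_distrib cong: sum.cong)
    also have "\<dots> = (1 / d) ^ Suc k"
      using Suc sum_shifted_power_subfield[OF K(1) fin, of "q - 1 - k" t] by (simp add: q_def)
    finally show ?case .
  qed
  then show ?thesis
    by (simp add: d_def q_def)
qed

section \<open>From the projective line to a map on \<open>K\<close>\<close>

lemma ratfun_map_quotient:
  fixes P Q :: "'a::field poly"
  assumes "poly Q x \<noteq> 0"
  shows "ratfun_map (Fract P Q) (Affine x) = Affine (poly P x / poly Q x)"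
proof -
  obtain P' Q' where red: "reduced_form (Fract P Q) P' Q'"
    using reduced_form_exists by blast
  have "Q \<noteq> 0"
    using assms by auto
  then have "P * Q' = P' * Q"
    using red by (auto simp: reduced_form_def eq_fract)
  then have eq: "poly P x * poly Q' x = poly P' x * poly Q x"
    by (metis poly_mult)
  \<comment> \<open>If \<open>Q'\<close> vanished at \<open>x\<close>, cross-multiplication would
    make \<open>P'\<close> vanish there too, against Bezout.\<close>
  obtain u v where "u * P' + v * Q' = 1"
    using coprime_poly_bezout red unfolding reduced_form_def by blast
  then have "poly u x * poly P' x + poly v x * poly Q' x = 1"
    by (metis poly_1 poly_add poly_mult)
  then have "poly Q' x \<noteq> 0"
    using eq assms by auto
  then show ?thesis
    using ratfun_map_eq[OF red] eq assms by (simp add: field_simps)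
qed

lemma ratfun_map_linear_plus_poles:
  fixes a r s t x :: "'a::field"
  assumes "x \<noteq> r" "x \<noteq> s" "x \<noteq> t"
  shows "ratfun_map (ratC a * ratX + 1 / (ratX - ratC r) + 1 / (ratX - ratC s)
           + 1 / (ratX - ratC t)) (Affine x) =
         Affine (a * x + 1 / (x - r) + 1 / (x - s) + 1 / (x - t))"
proof -
  define A B C where ABC: "A = [:- r, 1:]" "B = [:- s, 1:]" "C = [:- t, 1:]"
  define P where "P = [:0, a:] * A * B * C + B * C + A * C + A * B"
  have nz: "A \<noteq> 0" "B \<noteq> 0" "C \<noteq> 0"
    by (simp_all add: ABC)
  have AX: "ratC a * ratX = to_fract [:0, a:]"
    by (simp add: ratC_def ratX_def flip: to_fract_mult)
  have poles: "ratX - ratC r = to_fract A" "ratX - ratC s = to_fract B" "ratX - ratC t = to_fract C"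
    by (simp_all add: ABC ratC_def ratX_def flip: to_fract_diff)
  have "ratC a * ratX + 1 / (ratX - ratC r) + 1 / (ratX - ratC s) + 1 / (ratX - ratC t)
      = Fract P (A * B * C)"
    unfolding AX poles Fract_conv_to_fract P_def using nz by (simp add: field_simps flip: to_fract_mult)
  moreover have "poly P x / poly (A * B * C) x = a * x + 1 / (x - r) + 1 / (x - s) + 1 / (x - t)"
    proof -
    define \<alpha> \<beta> \<gamma> where "\<alpha> = x - r" "\<beta> = x - s" "\<gamma> = x - t"
    then have "\<alpha> \<noteq> 0" "\<beta> \<noteq> 0" "\<gamma> \<noteq> 0"
        "poly A x = \<alpha>" "poly B x = \<beta>" "poly C x = \<gamma>"
      using assms by (simp_all add: ABC)
    then show ?thesis
      unfolding \<open>\<alpha> = x - r\<close>[symmetric] \<open>\<beta> = x - s\<close>[symmetric] \<open>\<gamma> = x - t\<close>[symmetric]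
      by (simp add: P_def field_simps)
  qed
  moreover have "poly (A * B * C) x \<noteq> 0"
    unfolding poly_mult using assms by (simp add: ABC)
  ultimately show ?thesis
    by (simp add: ratfun_map_quotient)
qed

text \<open>No element of \<open>K\<close> goes to \<open>Infinity\<close>, so \<open>F\<close>
  inherits injectivity and maps \<open>K\<close> into itself; finiteness gives surjectivity.\<close>

lemma permutation_ratfun_imp_bij_betw:
  assumes "permutation_ratfun K f" "finite K"
    and F: "\<And>x. x \<in> K \<Longrightarrow> ratfun_map f (Affine x) = Affine (F x)"
  shows "bij_betw F K K"
proof -
  have bij: "bij_betw (ratfun_map f) (proj_line_over K) (proj_line_over K)"
    using assms(1) unfolding permutation_ratfun_def .
  have mem: "Affine x \<in> proj_line_over K \<longleftrightarrow> x \<in> K" for x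
    by (auto simp: proj_line_over_def)
  have "inj_on F K"
    by (rule inj_onI) (metis F mem bij bij_betw_imp_inj_on inj_onD proj_line.inject)
  moreover have "F ` K \<subseteq> K"
    by (metis F mem bij bij_betwE image_subsetI)
  ultimately show ?thesis
    using assms(2) by (simp add: bij_betw_def endo_inj_surj)
qed

section \<open>Partial fractions and the first three power sums\<close>

lemma mult_simple_pole:
  fixes x r :: "'a::field"
  assumes "x \<noteq> r"
  shows "x * (1 / (x - r)) = 1 + r * (1 / (x - r))"
  using assms by (simp add: divide_simps)

lemma mult_simple_poles:
  fixes x r s :: "'a::field"
  assumes "x \<noteq> r" "x \<noteq> s" "r \<noteq> s"
  shows "(1 / (x - r)) * (1 / (x - s)) = 1 / (r - s) * (1 / (x - r) - 1 / (x - s))"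
  using assms by (simp add: divide_simps)

text \<open>Partial fractions reduce powers of \<open>F\<close> to constants, powers of
  \<open>x\<close> and powers of single poles. The first two kinds sum to 0, as
  \<open>3 < card K - 1\<close>.\<close>

lemma sum_linear_plus_poles:
  fixes K :: "'a::finite_field set" and a r\<^sub>1 r\<^sub>2 r\<^sub>3 :: 'a
  assumes K: "is_subfield K" "primepow (card K)" "card K \<ge> 5"
    and r: "r\<^sub>1 \<notin> K" "r\<^sub>2 \<notin> K" "r\<^sub>3 \<notin> K" "r\<^sub>1 \<noteq> r\<^sub>2" "r\<^sub>1 \<noteq> r\<^sub>3" "r\<^sub>2 \<noteq> r\<^sub>3"
  defines "F \<equiv> \<lambda>x. a * x + 1 / (x - r\<^sub>1) + 1 / (x - r\<^sub>2) + 1 / (x - r\<^sub>3)"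
    and "e\<^sub>1 \<equiv> 1 / (r\<^sub>1 ^ card K - r\<^sub>1)" and "e\<^sub>2 \<equiv> 1 / (r\<^sub>2 ^ card K - r\<^sub>2)"
    and "e\<^sub>3 \<equiv> 1 / (r\<^sub>3 ^ card K - r\<^sub>3)"
  shows "(\<Sum>x\<in>K. F x) = e\<^sub>1 + e\<^sub>2 + e\<^sub>3"
    and "(\<Sum>x\<in>K. F x ^ 2) = 2 * a * (r\<^sub>1 * e\<^sub>1 + r\<^sub>2 * e\<^sub>2 + r\<^sub>3 * e\<^sub>3) + e\<^sub>1 ^ 2 + e\<^sub>2 ^ 2 + e\<^sub>3 ^ 2
      + 2 * (1 / (r\<^sub>1 - r\<^sub>2) * (e\<^sub>1 - e\<^sub>2) + 1 / (r\<^sub>1 - r\<^sub>3) * (e\<^sub>1 - e\<^sub>3) + 1 / (r\<^sub>2 - r\<^sub>3) * (e\<^sub>2 - e\<^sub>3))"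
    and "(2 :: 'a) = 0 \<Longrightarrow> (\<Sum>x\<in>K. F x ^ 3) = a ^ 2 * (r\<^sub>1 ^ 2 * e\<^sub>1 + r\<^sub>2 ^ 2 * e\<^sub>2 + r\<^sub>3 ^ 2 * e\<^sub>3)
      + a * (e\<^sub>1 + e\<^sub>2 + e\<^sub>3 + r\<^sub>1 * e\<^sub>1 ^ 2 + r\<^sub>2 * e\<^sub>2 ^ 2 + r\<^sub>3 * e\<^sub>3 ^ 2) + e\<^sub>1 ^ 3 + e\<^sub>2 ^ 3 + e\<^sub>3 ^ 3
      + 1 / (r\<^sub>1 - r\<^sub>2) * (e\<^sub>1 ^ 2 - e\<^sub>2 ^ 2) + 1 / (r\<^sub>1 - r\<^sub>3) * (e\<^sub>1 ^ 2 - e\<^sub>3 ^ 2)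
      + 1 / (r\<^sub>2 - r\<^sub>3) * (e\<^sub>2 ^ 2 - e\<^sub>3 ^ 2)"
proof -
  define t\<^sub>1 t\<^sub>2 t\<^sub>3 where
    t_def: "t\<^sub>1 x = 1 / (x - r\<^sub>1)" "t\<^sub>2 x = 1 / (x - r\<^sub>2)" "t\<^sub>3 x = 1 / (x - r\<^sub>3)" for x
  define c\<^sub>1\<^sub>2 c\<^sub>1\<^sub>3 c\<^sub>2\<^sub>3 where
    c_def: "c\<^sub>1\<^sub>2 = 1 / (r\<^sub>1 - r\<^sub>2)" "c\<^sub>1\<^sub>3 = 1 / (r\<^sub>1 - r\<^sub>3)" "c\<^sub>2\<^sub>3 = 1 / (r\<^sub>2 - r\<^sub>3)"
  have fin: "finite K"
    by simp
  have F: "F x = a * x + t\<^sub>1 x + t\<^sub>2 x + t\<^sub>3 x" for x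
    by (simp add: F_def t_def)
  have p: "(\<Sum>x\<in>K. x) = 0" "(\<Sum>x\<in>K. x ^ 2) = 0" "(\<Sum>x\<in>K. x ^ 3) = 0"
    and card0: "of_nat (card K) = (0 :: 'a)"
    using sum_power_subfield_eq_0[OF K(1) fin, of 1] sum_power_subfield_eq_0[OF K(1) fin, of 2]
      sum_power_subfield_eq_0[OF K(1) fin, of 3] of_nat_card_subfield[OF K(1) fin] K(3)
    by simp_all
  have s: "(\<Sum>x\<in>K. t\<^sub>1 x ^ k) = e\<^sub>1 ^ k" "(\<Sum>x\<in>K. t\<^sub>2 x ^ k) = e\<^sub>2 ^ k" "(\<Sum>x\<in>K. t\<^sub>3 x ^ k) = e\<^sub>3 ^ k"
    if "k \<ge> 1" "k \<le> 3" for k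
    using sum_inverse_power_subfield[OF K(1,2), of _ k] r that K(3)
    unfolding t_def e\<^sub>1_def e\<^sub>2_def e\<^sub>3_def by simp_all
  note s1 = s[of 1, simplified] and s2 = s[of 2, simplified] and s3 = s[of 3, simplified]
  note sums = sum.distrib sum_subtractf p card0 s1 s2 s3
  have prods: "x * t\<^sub>1 x = 1 + r\<^sub>1 * t\<^sub>1 x" "x * t\<^sub>2 x = 1 + r\<^sub>2 * t\<^sub>2 x" "x * t\<^sub>3 x = 1 + r\<^sub>3 * t\<^sub>3 x"
    "t\<^sub>1 x * t\<^sub>2 x = c\<^sub>1\<^sub>2 * (t\<^sub>1 x - t\<^sub>2 x)" "t\<^sub>1 x * t\<^sub>3 x = c\<^sub>1\<^sub>3 * (t\<^sub>1 x - t\<^sub>3 x)"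
    "t\<^sub>2 x * t\<^sub>3 x = c\<^sub>2\<^sub>3 * (t\<^sub>2 x - t\<^sub>3 x)" if "x \<in> K" for x
    unfolding t_def c_def by (rule mult_simple_pole mult_simple_poles; use r that in auto)+
  show "(\<Sum>x\<in>K. F x) = e\<^sub>1 + e\<^sub>2 + e\<^sub>3"
    by (simp add: F sums flip: sum_distrib_left)
  have "F x ^ 2 = a ^ 2 * x ^ 2 + 2 * a * ((1 + r\<^sub>1 * t\<^sub>1 x) + (1 + r\<^sub>2 * t\<^sub>2 x) + (1 + r\<^sub>3 * t\<^sub>3 x))
      + t\<^sub>1 x ^ 2 + t\<^sub>2 x ^ 2 + t\<^sub>3 x ^ 2
      + 2 * (c\<^sub>1\<^sub>2 * (t\<^sub>1 x - t\<^sub>2 x) + c\<^sub>1\<^sub>3 * (t\<^sub>1 x - t\<^sub>3 x) + c\<^sub>2\<^sub>3 * (t\<^sub>2 x - t\<^sub>3 x))" if "x \<in> K" for x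
  proof -
    have "F x ^ 2 = a ^ 2 * x ^ 2 + 2 * a * (x * t\<^sub>1 x + x * t\<^sub>2 x + x * t\<^sub>3 x)
        + t\<^sub>1 x ^ 2 + t\<^sub>2 x ^ 2 + t\<^sub>3 x ^ 2
        + 2 * (t\<^sub>1 x * t\<^sub>2 x + t\<^sub>1 x * t\<^sub>3 x + t\<^sub>2 x * t\<^sub>3 x)"
      unfolding F by algebra
    then show ?thesis
      unfolding prods[OF that] by simp
  qed
  then show "(\<Sum>x\<in>K. F x ^ 2) = 2 * a * (r\<^sub>1 * e\<^sub>1 + r\<^sub>2 * e\<^sub>2 + r\<^sub>3 * e\<^sub>3) + e\<^sub>1 ^ 2 + e\<^sub>2 ^ 2 + e\<^sub>3 ^ 2
      + 2 * (1 / (r\<^sub>1 - r\<^sub>2) * (e\<^sub>1 - e\<^sub>2) + 1 / (r\<^sub>1 - r\<^sub>3) * (e\<^sub>1 - e\<^sub>3) + 1 / (r\<^sub>2 - r\<^sub>3) * (e\<^sub>2 - e\<^sub>3))"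
    by (simp add: sums flip: sum_distrib_left c_def cong: sum.cong)
  assume two: "(2 :: 'a) = 0"
  have "F x ^ 3 = a ^ 3 * x ^ 3 + a ^ 2 * ((x + r\<^sub>1 + r\<^sub>1 ^ 2 * t\<^sub>1 x)
        + (x + r\<^sub>2 + r\<^sub>2 ^ 2 * t\<^sub>2 x) + (x + r\<^sub>3 + r\<^sub>3 ^ 2 * t\<^sub>3 x))
      + a * ((t\<^sub>1 x + r\<^sub>1 * t\<^sub>1 x ^ 2) + (t\<^sub>2 x + r\<^sub>2 * t\<^sub>2 x ^ 2) + (t\<^sub>3 x + r\<^sub>3 * t\<^sub>3 x ^ 2))
      + t\<^sub>1 x ^ 3 + t\<^sub>2 x ^ 3 + t\<^sub>3 x ^ 3
      + c\<^sub>1\<^sub>2 * (t\<^sub>1 x ^ 2 - t\<^sub>2 x ^ 2) + c\<^sub>1\<^sub>3 * (t\<^sub>1 x ^ 2 - t\<^sub>3 x ^ 2)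
      + c\<^sub>2\<^sub>3 * (t\<^sub>2 x ^ 2 - t\<^sub>3 x ^ 2)" if "x \<in> K" for x
  proof -
    have x2: "x ^ 2 * t\<^sub>1 x = x + r\<^sub>1 + r\<^sub>1 ^ 2 * t\<^sub>1 x" "x ^ 2 * t\<^sub>2 x = x + r\<^sub>2 + r\<^sub>2 ^ 2 * t\<^sub>2 x"
      "x ^ 2 * t\<^sub>3 x = x + r\<^sub>3 + r\<^sub>3 ^ 2 * t\<^sub>3 x"
      "x * t\<^sub>1 x ^ 2 = t\<^sub>1 x + r\<^sub>1 * t\<^sub>1 x ^ 2" "x * t\<^sub>2 x ^ 2 = t\<^sub>2 x + r\<^sub>2 * t\<^sub>2 x ^ 2"
      "x * t\<^sub>3 x ^ 2 = t\<^sub>3 x + r\<^sub>3 * t\<^sub>3 x ^ 2"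
      using prods(1-3)[OF that] by algebra+
    \<comment> \<open>The extra factor \<open>t\<^sub>1 x + t\<^sub>2 x\<close> turns the difference
      in the product rule into a difference of squares; likewise for the other pairs.\<close>
    have t2: "t\<^sub>1 x ^ 2 * t\<^sub>2 x + t\<^sub>1 x * t\<^sub>2 x ^ 2 = c\<^sub>1\<^sub>2 * (t\<^sub>1 x ^ 2 - t\<^sub>2 x ^ 2)"
      "t\<^sub>1 x ^ 2 * t\<^sub>3 x + t\<^sub>1 x * t\<^sub>3 x ^ 2 = c\<^sub>1\<^sub>3 * (t\<^sub>1 x ^ 2 - t\<^sub>3 x ^ 2)"
      "t\<^sub>2 x ^ 2 * t\<^sub>3 x + t\<^sub>2 x * t\<^sub>3 x ^ 2 = c\<^sub>2\<^sub>3 * (t\<^sub>2 x ^ 2 - t\<^sub>3 x ^ 2)"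
      using prods(4-6)[OF that] by algebra+
    \<comment> \<open>The multinomial coefficients 3 and 6 are split as \<open>1 + 2\<close> and
      \<open>2 * 3\<close>, which isolates the multiple of 2 that vanishes here.\<close>
    have "F x ^ 3 = a ^ 3 * x ^ 3
        + a ^ 2 * (x ^ 2 * t\<^sub>1 x + x ^ 2 * t\<^sub>2 x + x ^ 2 * t\<^sub>3 x)
        + a * (x * t\<^sub>1 x ^ 2 + x * t\<^sub>2 x ^ 2 + x * t\<^sub>3 x ^ 2)
        + t\<^sub>1 x ^ 3 + t\<^sub>2 x ^ 3 + t\<^sub>3 x ^ 3
        + (t\<^sub>1 x ^ 2 * t\<^sub>2 x + t\<^sub>1 x * t\<^sub>2 x ^ 2) + (t\<^sub>1 x ^ 2 * t\<^sub>3 x + t\<^sub>1 x * t\<^sub>3 x ^ 2)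
        + (t\<^sub>2 x ^ 2 * t\<^sub>3 x + t\<^sub>2 x * t\<^sub>3 x ^ 2)
        + 2 * (a ^ 2 * x ^ 2 * (t\<^sub>1 x + t\<^sub>2 x + t\<^sub>3 x) + a * x * (t\<^sub>1 x ^ 2 + t\<^sub>2 x ^ 2 + t\<^sub>3 x ^ 2)
          + 3 * a * x * (t\<^sub>1 x * t\<^sub>2 x + t\<^sub>1 x * t\<^sub>3 x + t\<^sub>2 x * t\<^sub>3 x)
          + (t\<^sub>1 x + t\<^sub>2 x) * (t\<^sub>1 x + t\<^sub>3 x) * (t\<^sub>2 x + t\<^sub>3 x) + t\<^sub>1 x * t\<^sub>2 x * t\<^sub>3 x)"
      unfolding F by algebra
    then show ?thesis
      unfolding x2 t2 two by simp
  qed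
  then show "(\<Sum>x\<in>K. F x ^ 3) = a ^ 2 * (r\<^sub>1 ^ 2 * e\<^sub>1 + r\<^sub>2 ^ 2 * e\<^sub>2 + r\<^sub>3 ^ 2 * e\<^sub>3)
      + a * (e\<^sub>1 + e\<^sub>2 + e\<^sub>3 + r\<^sub>1 * e\<^sub>1 ^ 2 + r\<^sub>2 * e\<^sub>2 ^ 2 + r\<^sub>3 * e\<^sub>3 ^ 2) + e\<^sub>1 ^ 3 + e\<^sub>2 ^ 3 + e\<^sub>3 ^ 3
      + 1 / (r\<^sub>1 - r\<^sub>2) * (e\<^sub>1 ^ 2 - e\<^sub>2 ^ 2) + 1 / (r\<^sub>1 - r\<^sub>3) * (e\<^sub>1 ^ 2 - e\<^sub>3 ^ 2)
      + 1 / (r\<^sub>2 - r\<^sub>3) * (e\<^sub>2 ^ 2 - e\<^sub>3 ^ 2)"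
    by (simp add: sums add_ac flip: sum_distrib_left c_def cong: sum.cong)
qed

section \<open>Contradiction from the power sums of \<open>F\<close>\<close>

theorem theorem4p4:
  fixes q :: nat and K :: "'a::finite_field set" and a r :: 'a and f :: "'a poly fract"
  assumes "primepow q" and "q \<ge> 5" and "CHAR('a) \<noteq> 3"
    and "card (UNIV :: 'a set) = q ^ 3"
    and "is_subfield K" and "card K = q"
    and "a \<in> K - {0}" and "r \<in> UNIV - K"
    and "f = ratC a * ratX + 1 / (ratX - ratC r) + 1 / (ratX - ratC (r ^ q))
           + 1 / (ratX - ratC (r ^ (q ^ 2)))"
  shows "\<not> permutation_ratfun K f"
proof
  assume perm: "permutation_ratfun K f"
  define s t where st: "s = r ^ q" "t = r ^ q ^ 2"
  \<comment> \<open>The ratio \<open>w\<close> of consecutive differences makes all later identities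
    polynomial in \<open>a\<close>, \<open>r\<close>, \<open>u\<close>, \<open>w\<close> and
    \<open>1 / u\<close>.\<close>
  define u where "u = s - r"
  define w where "w = (t - s) / u"
  define F where "F x = a * x + 1 / (x - r) + 1 / (x - s) + 1 / (x - t)" for x
  have K: "is_subfield K" "primepow (card K)" "card K \<ge> 5" and fin: "finite K"
    using assms by simp_all
  have K_iff: "x \<in> K \<longleftrightarrow> x ^ q = x" for x
    using subfield_eq_power_card_fixpoints[OF K(1) fin] assms(6) by blast
  \<comment> \<open>The field has \<open>q ^ 3\<close> elements, so the \<open>q\<close>-th power
    map cycles \<open>r\<close>, \<open>s\<close>, \<open>t\<close>.\<close>
  have frob: "r ^ q = s" "s ^ q = t" "t ^ q = r"
    using finite_field_power_card_eq_same[of r] assms(4)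
    by (simp_all add: st power2_eq_square power3_eq_cube mult.assoc flip: power_mult)
  have notin: "r \<notin> K" "s \<notin> K" "t \<notin> K"
    using assms(8) frob by (auto simp: K_iff)
  \<comment> \<open>Each pair consists of an element and its \<open>q\<close>-th power; equality
    would put that element in \<open>K\<close>.\<close>
  then have dist: "r \<noteq> s" "r \<noteq> t" "s \<noteq> t"
    using frob by (auto simp: K_iff)
  have three: "(3 :: 'a) \<noteq> 0"
  proof
    assume "(3 :: 'a) = 0"
    then have "CHAR('a) dvd 3"
      using of_nat_eq_0_iff_char_dvd[of 3, where ?'a = 'a] by simp
    then show False
      using assms(3) primes_dvd_imp_eq[of "CHAR('a)" 3] prime_CHAR_semidom[where ?'a = 'a] by simp
  qed
  have bij: "bij_betw F K K"
  proof (rule permutation_ratfun_imp_bij_betw[OF perm fin])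
    show "ratfun_map f (Affine x) = Affine (F x)" if "x \<in> K" for x
      unfolding assms(9) F_def st[symmetric]
      by (rule ratfun_map_linear_plus_poles) (use that notin in auto)
  qed
  have power_sum: "(\<Sum>x\<in>K. F x ^ k) = 0" if "k \<le> 3" for k
    using sum.reindex_bij_betw[OF bij, of "\<lambda>x. x ^ k"] sum_power_subfield_eq_0[OF K(1) fin, of k]
      that K(3) by simp
  note F_sums = sum_linear_plus_poles[OF K notin dist, of a, folded F_def,
      unfolded assms(6) frob]
  have u: "u \<noteq> 0"
    using dist by (simp add: u_def)
  have s: "s = r + u" and t: "t = r + u + w * u"
    using u by (simp_all add: u_def w_def)
  have w_nz: "w \<noteq> 0"
    using u dist by (simp add: w_def)
  have "1 / (s - r) + 1 / (t - s) + 1 / (r - t) = 0"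
    using F_sums(1) power_sum[of 1] by simp
  then have "(t - s) * (r - t) + (s - r) * (r - t) + (s - r) * (t - s) = 0"
    using dist by (simp add: divide_simps) algebra
  then have "u ^ 2 * (w ^ 2 + w + 1) = 0"
    unfolding s t by algebra
  then have w: "w ^ 2 + w + 1 = 0"
    using u by simp
  then have w3: "w ^ 3 = 1"
    by algebra
  define e where "e = 1 / u"
  have ue: "u * e = 1"
    using u by (simp add: e_def)
  \<comment> \<open>Here \<open>1 / w = w ^ 2\<close>, and
    \<open>r - t = - (1 + w) * u = w ^ 2 * u\<close>.\<close>
  have e: "1 / (s - r) = e" "1 / (t - s) = w ^ 2 * e" "1 / (r - t) = w * e"
    "1 / (r - s) = - e" "1 / (s - t) = - (w ^ 2) * e"
  proof -
    have inv: "1 / x = y" if "x * y = 1" for x y :: 'a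
      using that by (metis nonzero_eq_divide_eq mult.commute mult_zero_left zero_neq_one)
    show "1 / (s - r) = e" "1 / (t - s) = w ^ 2 * e" "1 / (r - t) = w * e"
      "1 / (r - s) = - e" "1 / (s - t) = - (w ^ 2) * e"
      by (rule inv; use ue w in \<open>unfold s t\<close>, algebra)+
  qed
  have w_ne_1: "w \<noteq> 1"
    using w three by auto
  show False
  proof (cases "(2 :: 'a) = 0")
    case False
    \<comment> \<open>The squares give \<open>e ^ 2 * (1 + w + w ^ 2) = 0\<close> and the pole
      products cancel. The factor of \<open>2 * a\<close> is
      \<open>2 * w ^ 2 + w = w ^ 2 - 1\<close>.\<close>
    have "(\<Sum>x\<in>K. F x ^ 2) = 2 * a * (w ^ 2 - 1)"
      unfolding F_sums(2) e unfolding s t using ue w by algebra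
    then have "w ^ 2 = 1"
      using power_sum[of 2] False assms(7) by simp
    then show False
      using w3 w_ne_1 by (simp add: power3_eq_cube power2_eq_square)
  next
    case True
    \<comment> \<open>The terms linear in \<open>a\<close> cancel; the cubes and pole products give
      \<open>3 * w * e ^ 3\<close>, and the \<open>a ^ 2\<close> terms an even multiple. Only
      \<open>w * e ^ 3\<close> survives modulo 2.\<close>
    have "(\<Sum>x\<in>K. F x ^ 3) = w * e ^ 3
        + 2 * (a ^ 2 * (r * (w ^ 2 - 1) + u * w ^ 2) + w * e ^ 3)"
      unfolding F_sums(3)[OF True] e unfolding s t using ue w by algebra
    then show False
      using power_sum[of 3] w_nz ue True by auto
  qed
qed

end
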